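(* Consider the semi-discrete numerical approximation described in the context, with solution $\mathbf u:[0,T]\to\mathbb R^N$, with penalty parameters $\tau_L=-\tau_R=1$ and homogeneous boundary data $\mathbf b_L=\mathbf b_R=\mathbf 0$. If the real boundary parameters satisfy $\alpha_L^2+\beta_L^2\ne0$, $\alpha_R^2+\beta_R^2\ne0$, $\alpha_L\beta_L\le0$, $\alpha_R\beta_R\ge0$ and $\alpha_L,\alpha_R$ are nonzero, then the square root of the semi-discrete energy $\mathcal E$ satisfies $$\sqrt{\mathcal E(t)}\le e^{-\gamma_ht}\left(\sqrt{\mathcal E(0)}+\int_0^te^{\gamma_hs}\|\mathbf c^{-1}\mathbf S(s)\|_{H_x}\,ds\right)\qquad\forall t\in[0,T],$$ where $$\gamma_h=\min_{s\in[0,t]}\frac{\left\|\mathbf c^{-1}\pmb\sigma\left.\frac{d\mathbf u}{dt}\right|_{t=s}\right\|_{H_x}^2+\operatorname{BT}_h(s)}{2\mathcal E(s)}\ge0$$ and $\operatorname{BT}_h(t)=\frac{\beta_R}{\alpha_R}\left(\frac{du_N}{dt}\right)^2-\frac{\beta_L}{\alpha_L}\left(\frac{du_1}{dt}\right)^2\ge0$.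
   Context: Space grid: $\Omega=[x_L,x_R]$, uniform points $x_1=x_L,\dots,x_N=x_R$, $\Delta x=(x_R-x_L)/(N-1)$; for a function $f$ on $\Omega$, $\mathbf f=[f(x_1),\dots,f(x_N)]^\top$. A triplet $(D_x^-,D_x^+,H_x)$ of linear operators on $\mathbb R^N$ satisfies the dual-pairing summation-by-parts (DP-SBP) framework if: (A.1) $H_x$ defines a positive discrete measure: with $(\mathbf f,\mathbf g)_{H_x}=\mathbf f^\top H_x\mathbf g$, $(\mathbf f,\mathbf f)_{H_x}>0$ for all $\mathbf f\ne\mathbf 0$, and $(\mathbf 1,\mathbf f)_{H_x}=\sum_{i=1}^N h_if(x_i)\Delta x\to\int_{x_L}^{x_R}f\,dx$ weakly as $N\to\infty$ for any $f\in L^2(\Omega)$; (A.2) $(D_x^\pm\mathbf f)_i=f'(x_i)$ for all polynomials $f$ of degree at most $p$; (A.3) $(D_x^+\mathbf f,\mathbf g)_{H_x}+(\mathbf f,D_x^-\mathbf g)_{H_x}=f_Ng_N-f_1g_1$ for all $\mathbf f,\mathbf g\in\mathbb R^N$; (A.4) $(\mathbf f,(D_x^+-D_x^-)\mathbf f)_{H_x}\le0$ for all $\mathbf f\in\mathbb R^N$. Write $\|\mathbf f\|_{H_x}^2=(\mathbf f,\mathbf f)_{H_x}$. Let $(D_x^-,D_x^+,H_x)$ be such a triplet. $\mathbf c=\operatorname{diag}(c(x_1),\dots,c(x_N))$ with $c(x)\neq0$ the wave speed, $\pmb\sigma=\operatorname{diag}(\sigma(x_1),\dots,\sigma(x_N))$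 with $\sigma$ the damping coefficient; $e_1,e_N\in\mathbb R^N$ are the first and last standard basis vectors; $\mathbf S(t)\in\mathbb R^N$ is the source grid function; $\mathbf b_L(t)=b_L(t)e_1$, $\mathbf b_R(t)=b_R(t)e_N$ are boundary data; $\mathbf f,\mathbf g\in\mathbb R^N$ are initial data. The semi-discrete approximation for $\mathbf u=[u_1,\dots,u_N]^\top$ is $$\frac{d^2\mathbf u}{dt^2}+\pmb\sigma^2\frac{d\mathbf u}{dt}=\mathbf c^2D_x^+D_x^-\mathbf u+\mathbf S(t)+\tau_L\mathbf c^2H_x^{-1}e_1e_1^\top\left(D_x^-\mathbf u+\frac{\beta_L}{\alpha_L}\frac{d\mathbf u}{dt}-\frac1{\alpha_L}\mathbf b_L(t)\right)+\tau_R\mathbf c^2H_x^{-1}e_Ne_N^\top\left(D_x^-\mathbf u+\frac{\beta_R}{\alpha_R}\frac{d\mathbf u}{dt}-\frac1{\alpha_R}\mathbf b_R(t)\right),$$ $\mathbf u(0)=\mathbf f$, $\frac{d\mathbf u}{dt}|_{t=0}=\mathbf g$, for $t\in[0,T]$. The semi-discrete energy is $\mathcal E(t)=\frac12\left(\left\|\mathbf c^{-1}\frac{d\mathbf u}{dt}\right\|_{H_x}^2+\|D_x^-\mathbf u\|_{H_x}^2\right)$. *)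

theory Defs
  imports "HOL-Analysis.Analysis" "Jordan_Normal_Form.Gauss_Jordan_Elimination"
    "HOL-Computational_Algebra.Polynomial"
begin

unbundle no inner_syntax
unbundle no vec_syntax

text \<open>
  Grid functions are vectors and grid operators are matrices of the library type with explicit
  dimensions, since the number \<open>N\<close> of grid points must be free to tend to infinity. Indices
  start at 0: the grid point written \<open>x\<^sub>i\<close>, \<open>1 \<le> i \<le> N\<close>, in the usual notation
  is \<open>grid_pt xL xR N (i - 1)\<close>.
\<close>

definition grid_dx :: "real \<Rightarrow> real \<Rightarrow> nat \<Rightarrow> real" where
  "grid_dx xL xR N = (xR - xL) / (real N - 1)"

definition grid_pt :: "real \<Rightarrow> real \<Rightarrow> nat \<Rightarrow> nat \<Rightarrow> real" where
  "grid_pt xL xR N i = xL + real i * grid_dx xL xR N"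

definition grid_fun :: "real \<Rightarrow> real \<Rightarrow> nat \<Rightarrow> (real \<Rightarrow> real) \<Rightarrow> real vec" where
  "grid_fun xL xR N f = Matrix.vec N (\<lambda>i. f (grid_pt xL xR N i))"

definition grid_diag :: "real \<Rightarrow> real \<Rightarrow> nat \<Rightarrow> (real \<Rightarrow> real) \<Rightarrow> real mat" where
  "grid_diag xL xR N f = mat_diag N (\<lambda>i. f (grid_pt xL xR N i))"

definition ip_H :: "real mat \<Rightarrow> real vec \<Rightarrow> real vec \<Rightarrow> real" where
  "ip_H H f g = f \<bullet> (H *\<^sub>v g)"

definition norm_H :: "real mat \<Rightarrow> real vec \<Rightarrow> real" where
  "norm_H H f = sqrt (ip_H H f f)"

text \<open>
  The conditions on the triplet for one fixed number of grid points. That \<open>H\<close> is a discrete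
  measure means that it is given by quadrature weights \<open>h i * \<Delta>x\<close> at the grid
  points, so \<open>H\<close> is diagonal.
\<close>

definition dp_sbp_triplet ::
  "real \<Rightarrow> real \<Rightarrow> nat \<Rightarrow> nat \<Rightarrow> real mat \<Rightarrow> real mat \<Rightarrow> real mat \<Rightarrow> bool" where
  "dp_sbp_triplet xL xR p N Dm Dp H \<longleftrightarrow>
     Dm \<in> carrier_mat N N \<and> Dp \<in> carrier_mat N N \<and>
     (\<exists>h. H = mat_diag N (\<lambda>i. h i * grid_dx xL xR N)) \<and>
     (\<forall>f\<in>carrier_vec N. f \<noteq> 0\<^sub>v N \<longrightarrow> ip_H H f f > 0) \<and>
     (\<forall>q :: real poly. degree q \<le> p \<longrightarrow>
        Dm *\<^sub>v grid_fun xL xR N (poly q) = grid_fun xL xR N (poly (pderiv q)) \<and>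
        Dp *\<^sub>v grid_fun xL xR N (poly q) = grid_fun xL xR N (poly (pderiv q))) \<and>
     (\<forall>f\<in>carrier_vec N. \<forall>g\<in>carrier_vec N.
        ip_H H (Dp *\<^sub>v f) g + ip_H H f (Dm *\<^sub>v g) = f $ (N - 1) * g $ (N - 1) - f $ 0 * g $ 0) \<and>
     (\<forall>f\<in>carrier_vec N. ip_H H f ((Dp - Dm) *\<^sub>v f) \<le> 0)"

text \<open>
  The full framework: a family of triplets, one for every sufficiently large \<open>N\<close> (accuracy of
  order \<open>p\<close> is impossible on too few points), whose discrete measures converge weakly to
  Lebesgue measure. The test functions are the continuous ones, as usual for weak convergence of
  measures. Arbitrary square-integrable test functions would make the condition unsatisfiable,
  because such a function may be changed at all (countably many) grid points without changing
  its integral.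
\<close>

definition dp_sbp ::
  "real \<Rightarrow> real \<Rightarrow> nat \<Rightarrow> nat \<Rightarrow> (nat \<Rightarrow> real mat) \<Rightarrow> (nat \<Rightarrow> real mat) \<Rightarrow> (nat \<Rightarrow> real mat) \<Rightarrow> bool" where
  "dp_sbp xL xR p N0 Dm Dp H \<longleftrightarrow>
     2 \<le> N0 \<and>
     (\<forall>N\<ge>N0. dp_sbp_triplet xL xR p N (Dm N) (Dp N) (H N)) \<and>
     (\<forall>f. continuous_on {xL..xR} f \<longrightarrow>
        (\<lambda>N. ip_H (H N) (grid_fun xL xR N (\<lambda>_. 1)) (grid_fun xL xR N f))
          \<longlonglongrightarrow> integral {xL..xR} f)"

definition vec_deriv_on ::
  "nat \<Rightarrow> real set \<Rightarrow> (real \<Rightarrow> real vec) \<Rightarrow> (real \<Rightarrow> real vec) \<Rightarrow> bool" where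
  "vec_deriv_on N I u v \<longleftrightarrow>
     (\<forall>t\<in>I. u t \<in> carrier_vec N \<and> v t \<in> carrier_vec N \<and>
       (\<forall>i<N. ((\<lambda>s. u s $ i) has_real_derivative v t $ i) (at t within I)))"

text \<open>The value is only meaningful for invertible matrices.\<close>

definition mat_inv :: "real mat \<Rightarrow> real mat" where
  "mat_inv A = the (mat_inverse A)"

text \<open>
  The penalty term \<open>\<tau> C\<^sup>2 H\<^sup>-\<^sup>1 e e\<^sup>T r\<close>, with
  \<open>e e\<^sup>T r\<close> written as \<open>(e \<bullet> r) e\<close>.
\<close>

definition sat :: "real \<Rightarrow> real mat \<Rightarrow> real mat \<Rightarrow> real vec \<Rightarrow> real vec \<Rightarrow> real vec" where
  "sat \<tau> C H e r = \<tau> \<cdot>\<^sub>v ((C ^\<^sub>m 2) *\<^sub>v (mat_inv H *\<^sub>v ((e \<bullet> r) \<cdot>\<^sub>v e)))"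

text \<open>
  Here \<open>C\<close> and \<open>Sg\<close> are the diagonal matrices of the wave speed and of the damping
  coefficient, and \<open>v\<close> is the time derivative of \<open>u\<close> (one-sided at the end points
  of the time interval).
\<close>

definition semidiscrete_solution ::
  "nat \<Rightarrow> real \<Rightarrow> real mat \<Rightarrow> real mat \<Rightarrow> real mat \<Rightarrow> real mat \<Rightarrow> real mat \<Rightarrow>
   real \<Rightarrow> real \<Rightarrow> real \<Rightarrow> real \<Rightarrow> real \<Rightarrow> real \<Rightarrow> (real \<Rightarrow> real) \<Rightarrow> (real \<Rightarrow> real) \<Rightarrow>
   (real \<Rightarrow> real vec) \<Rightarrow> real vec \<Rightarrow> real vec \<Rightarrow> (real \<Rightarrow> real vec) \<Rightarrow> (real \<Rightarrow> real vec) \<Rightarrow> bool" where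
  "semidiscrete_solution N T C Sg Dm Dp H \<tau>L \<tau>R \<alpha>L \<beta>L \<alpha>R \<beta>R bL bR S f g u v \<longleftrightarrow>
     vec_deriv_on N {0..T} u v \<and>
     (\<exists>a. vec_deriv_on N {0..T} v a \<and>
       (\<forall>t\<in>{0..T}.
          a t + (Sg ^\<^sub>m 2) *\<^sub>v v t =
            (C ^\<^sub>m 2) *\<^sub>v (Dp *\<^sub>v (Dm *\<^sub>v u t)) + S t
            + sat \<tau>L C H (unit_vec N 0)
                (Dm *\<^sub>v u t + (\<beta>L / \<alpha>L) \<cdot>\<^sub>v v t - (1 / \<alpha>L) \<cdot>\<^sub>v (bL t \<cdot>\<^sub>v unit_vec N 0))
            + sat \<tau>R C H (unit_vec N (N - 1))
                (Dm *\<^sub>v u t + (\<beta>R / \<alpha>R) \<cdot>\<^sub>v v t - (1 / \<alpha>R) \<cdot>\<^sub>v (bR t \<cdot>\<^sub>v unit_vec N (N - 1))))) \<and>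
     u 0 = f \<and> v 0 = g"

definition energy_h ::
  "real mat \<Rightarrow> real mat \<Rightarrow> real mat \<Rightarrow> (real \<Rightarrow> real vec) \<Rightarrow> (real \<Rightarrow> real vec) \<Rightarrow> real \<Rightarrow> real" where
  "energy_h C Dm H u v t = ((norm_H H (mat_inv C *\<^sub>v v t))\<^sup>2 + (norm_H H (Dm *\<^sub>v u t))\<^sup>2) / 2"

definition BT_h ::
  "nat \<Rightarrow> real \<Rightarrow> real \<Rightarrow> real \<Rightarrow> real \<Rightarrow> (real \<Rightarrow> real vec) \<Rightarrow> real \<Rightarrow> real" where
  "BT_h N \<alpha>L \<beta>L \<alpha>R \<beta>R v t = \<beta>R / \<alpha>R * (v t $ (N - 1))\<^sup>2 - \<beta>L / \<alpha>L * (v t $ 0)\<^sup>2"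

text \<open>
  The quotient minimised by the decay rate. Where the energy vanishes, \<open>v\<close> and hence the
  numerator vanish too, and the quotient is 0 by the convention for division by zero.
\<close>

definition decay_quotient ::
  "nat \<Rightarrow> real mat \<Rightarrow> real mat \<Rightarrow> real mat \<Rightarrow> real mat \<Rightarrow> real \<Rightarrow> real \<Rightarrow> real \<Rightarrow> real \<Rightarrow>
   (real \<Rightarrow> real vec) \<Rightarrow> (real \<Rightarrow> real vec) \<Rightarrow> real \<Rightarrow> real" where
  "decay_quotient N C Sg Dm H \<alpha>L \<beta>L \<alpha>R \<beta>R u v s =
     ((norm_H H (mat_inv C *\<^sub>v (Sg *\<^sub>v v s)))\<^sup>2 + BT_h N \<alpha>L \<beta>L \<alpha>R \<beta>R v s)
       / (2 * energy_h C Dm H u v s)"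

end

theory Submission
  imports Defs
begin

text \<open>
  Testing the scheme with \<open>C\<^sup>-\<^sup>2 v\<close> in the \<open>H\<close> inner product, summation by parts turns
  \<open>(D\<^sup>+ D\<^sup>- u, v)\<close> into the rate of the potential energy plus boundary terms, which the penalty
  terms with \<open>\<tau>\<^sub>L = - \<tau>\<^sub>R = 1\<close> replace by the dissipation \<open>BT\<close>. So \<open>E' = (C\<^sup>-\<^sup>1 v, C\<^sup>-\<^sup>1 S) - P\<close>,
  where \<open>P \<ge> 2 \<gamma> E\<close> is the numerator of the decay quotient, and Cauchy-Schwarz
  gives a linear differential inequality for \<open>sqrt E\<close>.
\<close>

section \<open>Diagonal matrices and the weighted inner product that they define\<close>

lemma mat_diag_mult_vec:
  assumes "x \<in> carrier_vec n"
  shows "mat_diag n d *\<^sub>v x = Matrix.vec n (\<lambda>i. d i * x $ i)"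
proof (rule eq_vecI)
  fix i assume "i < dim_vec (Matrix.vec n (\<lambda>i. d i * x $ i))"
  then have i: "i < n" by simp
  have "(mat_diag n d *\<^sub>v x) $ i = (\<Sum>j = 0..<n. (if i = j then d j else 0) * x $ j)"
    using i assms by (auto simp: mat_diag_def scalar_prod_def)
  also have "\<dots> = (\<Sum>j = 0..<n. if i = j then d j * x $ j else 0)"
    by (intro sum.cong) auto
  finally show "(mat_diag n d *\<^sub>v x) $ i = Matrix.vec n (\<lambda>i. d i * x $ i) $ i"
    using i by simp
qed (simp add: mat_diag_def)

lemma mat_diag_pow2: "mat_diag n d ^\<^sub>m 2 = mat_diag n (\<lambda>i. (d i)\<^sup>2)" for d :: "nat \<Rightarrow> real"
  using mat_diag_dim[of n d] by (simp add: numeral_2_eq_2 power2_eq_square)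

text \<open>\<open>mat_inv\<close> unpacks the result of an elimination algorithm. The explicit
  two-sided inverse makes the matrix a unit of the matrix ring, which rules out \<open>None\<close>;
  uniqueness of inverses then identifies what the algorithm returns.\<close>

lemma mat_inv_mat_diag:
  assumes "\<And>i. i < n \<Longrightarrow> d i \<noteq> 0"
  shows "mat_inv (mat_diag n d) = mat_diag n (\<lambda>i. inverse (d i))"
proof -
  let ?A = "mat_diag n d" and ?B = "mat_diag n (\<lambda>i. inverse (d i))"
  have A: "?A \<in> carrier_mat n n" and B: "?B \<in> carrier_mat n n" by simp_all
  have AB: "?A * ?B = 1\<^sub>m n" and BA: "?B * ?A = 1\<^sub>m n"
    using assms unfolding mat_diag_diag by (auto simp: mat_diag_def intro!: eq_matI)
  show ?thesis
  proof (cases "mat_inverse ?A")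
    case None
    from mat_inverse(1)[OF A this] have "?A \<notin> Units (ring_mat TYPE(real) n ())" .
    moreover have "?A \<in> Units (ring_mat TYPE(real) n ())"
      unfolding Units_def ring_mat_simps mem_Collect_eq using A B AB BA by blast
    ultimately show ?thesis by blast
  next
    case (Some B')
    from mat_inverse(2)[OF A this]
    have B': "?A * B' = 1\<^sub>m n" "B' * ?A = 1\<^sub>m n" "B' \<in> carrier_mat n n" by auto
    have "B' = B' * (?A * ?B)" using AB B' by simp
    also have "\<dots> = (B' * ?A) * ?B" by (rule assoc_mult_mat[OF B'(3) A B, symmetric])
    also have "\<dots> = ?B" unfolding B'(2) using B by (rule left_mult_one_mat)
    finally show ?thesis using Some by (simp add: mat_inv_def)
  qed
qed

lemma ip_H_mat_diag:
  assumes "x \<in> carrier_vec n" "y \<in> carrier_vec n"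
  shows "ip_H (mat_diag n w) x y = (\<Sum>i<n. w i * x $ i * y $ i)"
  using assms
  by (auto simp: ip_H_def mat_diag_mult_vec scalar_prod_def atLeast0LessThan intro!: sum.cong)

lemma norm_H_power2_mat_diag:
  assumes "x \<in> carrier_vec n" "\<And>i. i < n \<Longrightarrow> w i \<ge> 0"
  shows "(norm_H (mat_diag n w) x)\<^sup>2 = (\<Sum>i<n. w i * (x $ i)\<^sup>2)"
proof -
  have "ip_H (mat_diag n w) x x = (\<Sum>i<n. w i * (x $ i)\<^sup>2)"
    using assms(1) by (simp add: ip_H_mat_diag power2_eq_square mult.assoc)
  \<comment> \<open>The sign matters: \<open>sqrt\<close> is an odd function here, so squaring it
    would otherwise return an absolute value.\<close>
  moreover have "\<dots> \<ge> 0" using assms(2) by (intro sum_nonneg) auto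
  ultimately show ?thesis by (simp add: norm_H_def)
qed

text \<open>Scaling each component by \<open>sqrt (w i)\<close> turns the weighted norm into the
  Euclidean \<open>L2_set\<close> norm, where the classical inequality applies.\<close>

lemma ip_H_Cauchy_Schwarz:
  assumes x: "x \<in> carrier_vec n" and y: "y \<in> carrier_vec n"
    and w: "\<And>i. i < n \<Longrightarrow> w i \<ge> 0"
  shows "ip_H (mat_diag n w) x y \<le> norm_H (mat_diag n w) x * norm_H (mat_diag n w) y"
proof -
  let ?H = "mat_diag n w"
  have norm: "L2_set (\<lambda>i. sqrt (w i) * z $ i) {..<n} = norm_H ?H z" if "z \<in> carrier_vec n" for z
    using w that unfolding L2_set_def norm_H_def ip_H_mat_diag[OF that that]
    by (intro arg_cong[where f=sqrt] sum.cong refl) (simp add: power_mult_distrib power2_eq_square)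
  have "ip_H ?H x y = (\<Sum>i<n. (sqrt (w i) * x $ i) * (sqrt (w i) * y $ i))"
    using w unfolding ip_H_mat_diag[OF x y]
    by (intro sum.cong refl) (metis (no_types, lifting) lessThan_iff mult.assoc
        mult.left_commute real_sqrt_mult_self abs_of_nonneg)
  also have "\<dots> \<le> L2_set (\<lambda>i. sqrt (w i) * x $ i) {..<n} * L2_set (\<lambda>i. sqrt (w i) * y $ i) {..<n}"
    by (rule order_trans[OF sum_mono L2_set_mult_ineq]) (simp add: abs_mult[symmetric])
  also have "\<dots> = norm_H ?H x * norm_H ?H y" by (simp only: norm[OF x] norm[OF y])
  finally show ?thesis .
qed

section \<open>A Gronwall inequality for square roots, and minima of quotients\<close>

lemma integrable_exp_times:
  fixes w :: "real \<Rightarrow> real"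
  assumes w: "w integrable_on {a..b}" and nonneg: "\<And>s. s \<in> {a..b} \<Longrightarrow> w s \<ge> 0"
  shows "(\<lambda>s. exp (k * s) * w s) integrable_on {a..b}"
proof -
  have cont: "continuous_on {a..b} (\<lambda>s. exp (k * s))" by (intro continuous_intros)
  \<comment> \<open>Gauge integrability alone need not survive multiplication by a bounded
    measurable function. Nonnegativity upgrades it to absolute integrability, which does.\<close>
  have "w absolutely_integrable_on {a..b}"
    using w nonneg by (intro nonnegative_absolutely_integrable_1)
  then have "(\<lambda>s. exp (k * s) * w s) absolutely_integrable_on {a..b}"
    using cont
    by (intro absolutely_integrable_bounded_measurable_product_real
        compact_imp_bounded compact_continuous_image continuous_imp_measurable_on_sets_lebesgue) auto
  then show ?thesis by (rule set_lebesgue_integral_eq_integral(1))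
qed

text \<open>
  Adding \<open>\<epsilon>\<close> under the square root keeps it differentiable where the energy vanishes. The
  derivative need not be continuous: the fundamental theorem for the gauge integral applies to
  every function that is differentiable everywhere.
\<close>

lemma sqrt_energy_gronwall:
  fixes E E' w :: "real \<Rightarrow> real"
  assumes t: "0 \<le> t"
    and deriv: "\<And>s. s \<in> {0..t} \<Longrightarrow> (E has_real_derivative E' s) (at s within {0..t})"
    and E: "\<And>s. s \<in> {0..t} \<Longrightarrow> E s \<ge> 0"
    and le: "\<And>s. s \<in> {0..t} \<Longrightarrow> E' s \<le> - 2 * k * E s + 2 * sqrt (E s) * w s"
    and w: "\<And>s. s \<in> {0..t} \<Longrightarrow> w s \<ge> 0" "w integrable_on {0..t}"
  shows "sqrt (E t) \<le> exp (- k * t) * (sqrt (E 0) + integral {0..t} (\<lambda>s. exp (k * s) * w s))"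
proof -
  define I where "I = integral {0..t} (\<lambda>s. exp (k * s) * w s)"
  \<comment> \<open>The squared integrating factor: \<open>sqrt (F s)\<close> is
    \<open>exp (k * s) * sqrt (E s)\<close>, and differentiating \<open>F\<close> absorbs the term
    \<open>- 2 * k * E s\<close> of the hypothesis.\<close>
  define F where "F = (\<lambda>s. (exp (k * s))\<^sup>2 * E s)"
  have int: "(\<lambda>s. exp (k * s) * w s) integrable_on {0..t}"
    using w by (rule integrable_exp_times[rotated])
  have F0: "F s \<ge> 0" if "s \<in> {0..t}" for s using E[OF that] by (simp add: F_def)
  have bound: "sqrt (F t) \<le> sqrt (E 0 + e) + I" if e: "e > 0" for e
  proof -
    define G' where "G' = (\<lambda>s. (exp (k * s))\<^sup>2 * (E' s + 2 * k * E s) / (2 * sqrt (F s + e)))"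
    have "((\<lambda>s. sqrt (F s + e)) has_real_derivative G' s) (at s within {0..t})" if s: "s \<in> {0..t}" for s
      unfolding F_def G'_def using F0[OF s] e
      by (auto intro!: derivative_eq_intros deriv[OF s] simp: F_def divide_simps)
         (auto simp: algebra_simps power2_eq_square)
    then have ftc: "(G' has_integral (sqrt (F t + e) - sqrt (F 0 + e))) {0..t}"
      using t by (intro fundamental_theorem_of_calculus)
        (auto simp: has_real_derivative_iff_has_vector_derivative)
    have G'_le: "G' s \<le> exp (k * s) * w s" if s: "s \<in> {0..t}" for s
    proof -
      have sF: "sqrt (F s) = exp (k * s) * sqrt (E s)"
        by (simp add: F_def real_sqrt_mult)
      have pos: "sqrt (F s + e) > 0" using F0[OF s] e by simp
      have "(exp (k * s))\<^sup>2 * (E' s + 2 * k * E s) \<le> (exp (k * s))\<^sup>2 * (2 * sqrt (E s) * w s)"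
        using le[OF s] by (intro mult_left_mono) auto
      also have "\<dots> = 2 * (exp (k * s) * w s) * sqrt (F s)"
        unfolding sF by (simp add: power2_eq_square)
      \<comment> \<open>Passing from \<open>F s\<close> to \<open>F s + e\<close> produces exactly
        the denominator of \<open>G' s\<close>; since \<open>w s\<close> is nonnegative, this can
        only enlarge the bound.\<close>
      also have "\<dots> \<le> 2 * (exp (k * s) * w s) * sqrt (F s + e)"
        using w(1)[OF s] e by (intro mult_left_mono) auto
      finally show ?thesis
        using pos by (simp add: G'_def divide_le_eq mult_ac)
    qed
    have "F 0 = E 0" by (simp add: F_def)
    then have "sqrt (F t + e) - sqrt (E 0 + e) \<le> I"
      unfolding I_def using has_integral_le[OF ftc integrable_integral[OF int]] G'_le by metis
    moreover have "sqrt (F t) \<le> sqrt (F t + e)" using e by simp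
    ultimately show ?thesis by linarith
  qed
  \<comment> \<open>The bound holds for every positive \<open>e\<close> and its left side is free of
    \<open>e\<close>, so it persists in the limit from the right.\<close>
  have "((\<lambda>e. sqrt (E 0 + e) + I) \<longlongrightarrow> sqrt (E 0 + 0) + I) (at_right 0)"
    by (intro tendsto_intros)
  moreover have "\<forall>\<^sub>F e in at_right 0. sqrt (F t) \<le> sqrt (E 0 + e) + I"
    using bound by (intro eventually_at_right_less[THEN eventually_mono]) auto
  ultimately have "sqrt (F t) \<le> sqrt (E 0) + I"
    by (intro tendsto_lowerbound[of _ _ "at_right (0::real)"]) auto
  then have "exp (- k * t) * (exp (k * t) * sqrt (E t)) \<le> exp (- k * t) * (sqrt (E 0) + I)"
    by (intro mult_left_mono) (simp_all add: F_def real_sqrt_mult)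
  then show ?thesis
    by (simp add: I_def mult.assoc[symmetric] exp_add[symmetric])
qed

text \<open>If the denominator vanishes somewhere, the quotient is 0 there by convention, which is
  minimal among nonnegative values. Otherwise the quotient is continuous on a compact
  interval.\<close>

lemma nonneg_quotient_attains_min:
  fixes P E :: "real \<Rightarrow> real"
  assumes "a \<le> b" "continuous_on {a..b} P" "continuous_on {a..b} E"
    and "\<And>s. s \<in> {a..b} \<Longrightarrow> P s \<ge> 0" "\<And>s. s \<in> {a..b} \<Longrightarrow> E s \<ge> 0"
  shows "\<exists>s\<in>{a..b}. \<forall>r\<in>{a..b}. P s / E s \<le> P r / E r"
proof (cases "\<exists>s\<in>{a..b}. E s = 0")
  case True
  then obtain s where "s \<in> {a..b}" "E s = 0" by blast
  then show ?thesis using assms(4,5) by (intro bexI[of _ s]) auto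
next
  case False
  then have "continuous_on {a..b} (\<lambda>s. P s / E s)"
    using assms by (intro continuous_on_divide) auto
  then show ?thesis
    using assms(1) by (intro continuous_attains_inf) auto
qed


section \<open>The energy identity of the semi-discrete scheme\<close>

lemma mat_inv_mat_diag_mult_vec:
  assumes "\<And>i. i < n \<Longrightarrow> d i \<noteq> 0" "x \<in> carrier_vec n"
  shows "mat_inv (mat_diag n d) *\<^sub>v x = Matrix.vec n (\<lambda>i. x $ i / d i)"
  using assms by (auto simp: mat_inv_mat_diag mat_diag_mult_vec divide_inverse mult.commute)

text \<open>Because both matrices are diagonal, a penalty acts on its own boundary component only.
  Its factor \<open>(c i)\<^sup>2 / w i\<close> is what testing with
  \<open>w i * v t $ i / (c i)\<^sup>2\<close> cancels later.\<close>

lemma sat_mat_diag: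
  assumes "\<And>i. i < n \<Longrightarrow> w i \<noteq> 0" "r \<in> carrier_vec n" "j < n"
  shows "sat \<tau> (mat_diag n c) (mat_diag n w) (unit_vec n j) r =
    Matrix.vec n (\<lambda>i. if i = j then \<tau> * ((c i)\<^sup>2 / w i) * r $ i else 0)"
  using assms
  by (auto simp: sat_def mat_diag_pow2 mat_inv_mat_diag_mult_vec mat_diag_mult_vec scalar_prod_left_unit
      intro!: eq_vecI)

lemma has_real_derivative_mat_mult_vec:
  assumes uv: "vec_deriv_on n I u v" and D: "D \<in> carrier_mat m n" and t: "t \<in> I" and i: "i < m"
  shows "((\<lambda>s. (D *\<^sub>v u s) $ i) has_real_derivative (D *\<^sub>v v t) $ i) (at t within I)"
proof -
  have eq: "(D *\<^sub>v x) $ i = (\<Sum>j<n. D $$ (i, j) * x $ j)" if "x \<in> carrier_vec n" for x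
    using that D i by (auto simp: scalar_prod_def atLeast0LessThan intro!: sum.cong)
  have "((\<lambda>s. \<Sum>j<n. D $$ (i, j) * u s $ j) has_real_derivative (\<Sum>j<n. D $$ (i, j) * v t $ j))
    (at t within I)"
    using uv t unfolding vec_deriv_on_def by (intro derivative_intros DERIV_cmult) auto
  then have "((\<lambda>s. (D *\<^sub>v u s) $ i) has_real_derivative (\<Sum>j<n. D $$ (i, j) * v t $ j))
    (at t within I)"
    \<comment> \<open>The sum formula requires vectors of dimension \<open>n\<close>, which is known
      for times in \<open>I\<close> only; agreement within \<open>I\<close> suffices, and the radius
      1 is arbitrary.\<close>
    by (rule has_field_derivative_transform_within[where d = 1])
      (use uv t in \<open>auto simp: vec_deriv_on_def eq\<close>)
  then show ?thesis using uv t by (simp add: vec_deriv_on_def eq)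
qed

text \<open>With diagonal matrices the energy is a finite weighted sum of squares and can be
  differentiated termwise. The kinetic part comes out as \<open>a t\<close> tested with
  \<open>C\<^sup>-\<^sup>2 v\<close>, ready for substituting the scheme.\<close>

lemma has_real_derivative_energy_h:
  assumes uv: "vec_deriv_on n I u v" and va: "vec_deriv_on n I v a"
    and D: "D \<in> carrier_mat n n" and w: "\<And>i. i < n \<Longrightarrow> w i \<ge> 0"
    and c: "\<And>i. i < n \<Longrightarrow> c i \<noteq> 0" and t: "t \<in> I"
  shows "(energy_h (mat_diag n c) D (mat_diag n w) u v has_real_derivative
    (\<Sum>i<n. w i * v t $ i * a t $ i / (c i)\<^sup>2) + ip_H (mat_diag n w) (D *\<^sub>v u t) (D *\<^sub>v v t))
    (at t within I)"
proof -
  have u: "u s \<in> carrier_vec n" and v: "v s \<in> carrier_vec n" if "s \<in> I" for s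
    using uv that by (auto simp: vec_deriv_on_def)
  have eq: "energy_h (mat_diag n c) D (mat_diag n w) u v s =
    ((\<Sum>i<n. w i * (v s $ i)\<^sup>2 / (c i)\<^sup>2) + (\<Sum>i<n. w i * ((D *\<^sub>v u s) $ i)\<^sup>2)) / 2" if "s \<in> I" for s
    using u[OF that] v[OF that] D w c
    by (simp add: energy_h_def mat_inv_mat_diag_mult_vec norm_H_power2_mat_diag power_divide)
  have vi: "((\<lambda>s. v s $ i) has_real_derivative a t $ i) (at t within I)" if "i < n" for i
    using va t that by (auto simp: vec_deriv_on_def)
  have "((\<lambda>s. ((\<Sum>i<n. w i * (v s $ i)\<^sup>2 / (c i)\<^sup>2) + (\<Sum>i<n. w i * ((D *\<^sub>v u s) $ i)\<^sup>2)) / 2)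
    has_real_derivative
    ((\<Sum>i<n. w i * (2 * v t $ i * a t $ i) / (c i)\<^sup>2) +
     (\<Sum>i<n. w i * (2 * (D *\<^sub>v u t) $ i * (D *\<^sub>v v t) $ i))) / 2) (at t within I)"
    using vi has_real_derivative_mat_mult_vec[OF uv D t]
    by (intro DERIV_cdivide DERIV_add DERIV_sum DERIV_cmult) (auto intro!: derivative_eq_intros)
  then have "(energy_h (mat_diag n c) D (mat_diag n w) u v has_real_derivative
    ((\<Sum>i<n. w i * (2 * v t $ i * a t $ i) / (c i)\<^sup>2) +
     (\<Sum>i<n. w i * (2 * (D *\<^sub>v u t) $ i * (D *\<^sub>v v t) $ i))) / 2) (at t within I)"
    by (rule has_field_derivative_transform_within[where d = 1]) (use t in \<open>simp_all add: eq\<close>)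
  moreover have "((\<Sum>i<n. w i * (2 * v t $ i * a t $ i) / (c i)\<^sup>2) +
     (\<Sum>i<n. w i * (2 * (D *\<^sub>v u t) $ i * (D *\<^sub>v v t) $ i))) / 2 =
     (\<Sum>i<n. w i * v t $ i * a t $ i / (c i)\<^sup>2) + ip_H (mat_diag n w) (D *\<^sub>v u t) (D *\<^sub>v v t)"
    using D u[OF t] v[OF t]
    by (simp add: ip_H_mat_diag[of _ n] add_divide_distrib sum_divide_distrib mult_ac)
  ultimately show ?thesis by simp
qed

text \<open>This is an exact identity; estimates enter only when it is combined with Cauchy-Schwarz
  and the decay quotient.\<close>

lemma energy_rate:
  fixes \<alpha>L \<beta>L \<alpha>R \<beta>R :: real
  assumes N: "0 < N"
    and w: "\<And>i. i < N \<Longrightarrow> w i > 0" and c: "\<And>i. i < N \<Longrightarrow> c i \<noteq> 0"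
    and Dm: "Dm \<in> carrier_mat N N" and Dp: "Dp \<in> carrier_mat N N"
    and sbp: "\<And>x y. x \<in> carrier_vec N \<Longrightarrow> y \<in> carrier_vec N \<Longrightarrow>
      ip_H H (Dp *\<^sub>v x) y + ip_H H x (Dm *\<^sub>v y) = x $ (N - 1) * y $ (N - 1) - x $ 0 * y $ 0"
    and H: "H = mat_diag N w" and C: "C = mat_diag N c" and Sg: "Sg = mat_diag N \<sigma>"
    and sol: "semidiscrete_solution N T C Sg Dm Dp H 1 (-1) \<alpha>L \<beta>L \<alpha>R \<beta>R
      (\<lambda>_. 0) (\<lambda>_. 0) S f g u v"
    and t: "t \<in> {0..T}" and S: "S t \<in> carrier_vec N"
  shows "(energy_h C Dm H u v has_real_derivative
      ip_H H (mat_inv C *\<^sub>v v t) (mat_inv C *\<^sub>v S t) -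
      ((norm_H H (mat_inv C *\<^sub>v (Sg *\<^sub>v v t)))\<^sup>2 + BT_h N \<alpha>L \<beta>L \<alpha>R \<beta>R v t))
    (at t within {0..T})"
proof -
  from sol obtain a where uv: "vec_deriv_on N {0..T} u v" and va: "vec_deriv_on N {0..T} v a"
    and eqn: "a t + (Sg ^\<^sub>m 2) *\<^sub>v v t =
            (C ^\<^sub>m 2) *\<^sub>v (Dp *\<^sub>v (Dm *\<^sub>v u t)) + S t
            + sat 1 C H (unit_vec N 0)
                (Dm *\<^sub>v u t + (\<beta>L / \<alpha>L) \<cdot>\<^sub>v v t - (1 / \<alpha>L) \<cdot>\<^sub>v (0 \<cdot>\<^sub>v unit_vec N 0))
            + sat (-1) C H (unit_vec N (N - 1))
                (Dm *\<^sub>v u t + (\<beta>R / \<alpha>R) \<cdot>\<^sub>v v t - (1 / \<alpha>R) \<cdot>\<^sub>v (0 \<cdot>\<^sub>v unit_vec N (N - 1)))"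
    using t unfolding semidiscrete_solution_def by blast
  have ut: "u t \<in> carrier_vec N" and vt: "v t \<in> carrier_vec N" and at: "a t \<in> carrier_vec N"
    using uv va t by (auto simp: vec_deriv_on_def)
  define y where "y = Dm *\<^sub>v u t"
  have y: "y \<in> carrier_vec N" and Dy: "Dp *\<^sub>v y \<in> carrier_vec N"
    using Dm Dp ut by (auto simp: y_def)
  have w0: "w i \<noteq> 0" "w i \<ge> 0" if "i < N" for i using w[OF that] by auto
  \<comment> \<open>The residuals of the homogeneous boundary conditions at the two ends, that is,
    the scalars to which the penalties are proportional.\<close>
  define bL bR where "bL = y $ 0 + \<beta>L / \<alpha>L * v t $ 0"
    and "bR = y $ (N - 1) + \<beta>R / \<alpha>R * v t $ (N - 1)"
  have ai: "a t $ i = (c i)\<^sup>2 * (Dp *\<^sub>v y) $ i + S t $ i - (\<sigma> i)\<^sup>2 * v t $ i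
      + (if i = 0 then (c i)\<^sup>2 / w i * bL else 0) - (if i = N - 1 then (c i)\<^sup>2 / w i * bR else 0)"
    if i: "i < N" for i
  proof -
    have sat_L: "sat 1 C H (unit_vec N 0)
        (y + (\<beta>L / \<alpha>L) \<cdot>\<^sub>v v t - (1 / \<alpha>L) \<cdot>\<^sub>v (0 \<cdot>\<^sub>v unit_vec N 0)) $ i =
        (if i = 0 then (c i)\<^sup>2 / w i * bL else 0)"
      unfolding C H by (subst sat_mat_diag) (use y vt w0 N i in \<open>auto simp: bL_def\<close>)
    have sat_R: "sat (-1) C H (unit_vec N (N - 1))
        (y + (\<beta>R / \<alpha>R) \<cdot>\<^sub>v v t - (1 / \<alpha>R) \<cdot>\<^sub>v (0 \<cdot>\<^sub>v unit_vec N (N - 1))) $ i =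
        - (if i = N - 1 then (c i)\<^sup>2 / w i * bR else 0)"
      unfolding C H by (subst sat_mat_diag) (use y vt w0 N i in \<open>auto simp: bR_def\<close>)
    have dims: "dim_vec (sat \<tau> C H (unit_vec N j) r) = N" for \<tau> j r
      by (simp add: sat_def C mat_diag_pow2 mat_diag_def)
    have "(a t + (Sg ^\<^sub>m 2) *\<^sub>v v t) $ i = a t $ i + (\<sigma> i)\<^sup>2 * v t $ i"
      using at vt i by (simp add: Sg mat_diag_pow2 mat_diag_mult_vec)
    moreover have "(C ^\<^sub>m 2) *\<^sub>v (Dp *\<^sub>v y) = Matrix.vec N (\<lambda>i. (c i)\<^sup>2 * (Dp *\<^sub>v y) $ i)"
      using Dy by (simp add: C mat_diag_pow2 mat_diag_mult_vec)
    ultimately show ?thesis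
      using arg_cong[OF eqn, of "\<lambda>z. z $ i"] i S
      by (simp add: y_def[symmetric] sat_L[simplified] sat_R[simplified] dims)
  qed
  \<comment> \<open>Testing removes \<open>(c i)\<^sup>2\<close> from the stiffness term and the
    whole factor \<open>(c i)\<^sup>2 / w i\<close> from the penalties, leaving unweighted boundary
    products.\<close>
  have "(\<Sum>i<N. w i * v t $ i * a t $ i / (c i)\<^sup>2) =
    (\<Sum>i<N. w i * (Dp *\<^sub>v y) $ i * v t $ i + w i * (v t $ i / c i) * (S t $ i / c i)
      - w i * (\<sigma> i * v t $ i / c i)\<^sup>2
      + (if i = 0 then bL * v t $ i else 0) - (if i = N - 1 then bR * v t $ i else 0))"
  proof (rule sum.cong[OF refl])
    fix i assume "i \<in> {..<N}"
    then have i: "i < N" by simp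
    show "w i * v t $ i * a t $ i / (c i)\<^sup>2 =
      w i * (Dp *\<^sub>v y) $ i * v t $ i + w i * (v t $ i / c i) * (S t $ i / c i)
      - w i * (\<sigma> i * v t $ i / c i)\<^sup>2
      + (if i = 0 then bL * v t $ i else 0) - (if i = N - 1 then bR * v t $ i else 0)"
      unfolding ai[OF i] using c[OF i] w0(1)[OF i] by (auto simp: field_simps power2_eq_square)
  qed
  also have "\<dots> = ip_H H (Dp *\<^sub>v y) (v t) + ip_H H (mat_inv C *\<^sub>v v t) (mat_inv C *\<^sub>v S t)
      - (norm_H H (mat_inv C *\<^sub>v (Sg *\<^sub>v v t)))\<^sup>2 + bL * v t $ 0 - bR * v t $ (N - 1)"
    using N Dy vt S w0 c
    by (simp add: H C Sg ip_H_mat_diag[of _ N] mat_inv_mat_diag_mult_vec mat_diag_mult_vec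
        norm_H_power2_mat_diag sum.distrib sum_subtractf)
  \<comment> \<open>Summation by parts contributes
    \<open>y $ (N - 1) * v t $ (N - 1) - y $ 0 * v t $ 0\<close>. The \<open>y\<close> parts of
    \<open>bL\<close> and \<open>bR\<close> cancel it, and their \<open>v\<close> parts add up to
    minus \<open>BT_h\<close>.\<close>
  finally have "(\<Sum>i<N. w i * v t $ i * a t $ i / (c i)\<^sup>2) + ip_H H y (Dm *\<^sub>v v t) =
    ip_H H (mat_inv C *\<^sub>v v t) (mat_inv C *\<^sub>v S t) -
    ((norm_H H (mat_inv C *\<^sub>v (Sg *\<^sub>v v t)))\<^sup>2 + BT_h N \<alpha>L \<beta>L \<alpha>R \<beta>R v t)"
    using sbp[OF y vt] by (simp add: bL_def bR_def BT_h_def algebra_simps power2_eq_square)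
  then show ?thesis
    using has_real_derivative_energy_h[where w=w and c=c, OF uv va Dm w0(2) c t]
    by (simp add: H C y_def)
qed

section \<open>The decay estimate, from the energy identity and the scalar inequality\<close>

theorem theorem6:
  fixes xL xR T \<alpha>L \<beta>L \<alpha>R \<beta>R :: real
    and p N0 N :: nat
    and Dm Dp H :: "nat \<Rightarrow> real mat"
    and c \<sigma> :: "real \<Rightarrow> real"
    and C Sg :: "real mat"
    and S u v :: "real \<Rightarrow> real vec"
    and f g :: "real vec"
    and E q \<gamma> :: "real \<Rightarrow> real"
  defines "C \<equiv> grid_diag xL xR N c"
    and "Sg \<equiv> grid_diag xL xR N \<sigma>"
    and "E \<equiv> energy_h C (Dm N) (H N) u v"
    and "q \<equiv> decay_quotient N C Sg (Dm N) (H N) \<alpha>L \<beta>L \<alpha>R \<beta>R u v"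
    and "\<gamma> \<equiv> (\<lambda>t. INF s\<in>{0..t}. q s)"
  assumes "xL < xR" and "0 < T"
    and "dp_sbp xL xR p N0 Dm Dp H" and "N0 \<le> N"
    and "\<forall>x\<in>{xL..xR}. c x \<noteq> 0"
    and "\<forall>t\<in>{0..T}. S t \<in> carrier_vec N"
    and "(\<lambda>s. norm_H (H N) (mat_inv C *\<^sub>v S s)) integrable_on {0..T}"
    and "semidiscrete_solution N T C Sg (Dm N) (Dp N) (H N) 1 (-1) \<alpha>L \<beta>L \<alpha>R \<beta>R
           (\<lambda>_. 0) (\<lambda>_. 0) S f g u v"
    and "\<alpha>L\<^sup>2 + \<beta>L\<^sup>2 \<noteq> 0" and "\<alpha>R\<^sup>2 + \<beta>R\<^sup>2 \<noteq> 0"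
    and "\<alpha>L * \<beta>L \<le> 0" and "\<alpha>R * \<beta>R \<ge> 0"
    and "\<alpha>L \<noteq> 0" and "\<alpha>R \<noteq> 0"
  shows "\<forall>t\<in>{0..T}.
           BT_h N \<alpha>L \<beta>L \<alpha>R \<beta>R v t \<ge> 0 \<and>
           (\<exists>s\<in>{0..t}. q s = \<gamma> t \<and> (\<forall>r\<in>{0..t}. q s \<le> q r)) \<and>
           \<gamma> t \<ge> 0 \<and>
           (\<lambda>s. exp (\<gamma> t * s) * norm_H (H N) (mat_inv C *\<^sub>v S s)) integrable_on {0..t} \<and>
           sqrt (E t) \<le> exp (- \<gamma> t * t) *
             (sqrt (E 0) + integral {0..t} (\<lambda>s. exp (\<gamma> t * s) * norm_H (H N) (mat_inv C *\<^sub>v S s)))"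
proof (rule ballI)
  fix t assume t: "t \<in> {0..T}"
  have dp: "dp_sbp_triplet xL xR p N (Dm N) (Dp N) (H N)" and N2: "2 \<le> N"
    using assms(8,9) by (auto simp: dp_sbp_def)
  then obtain h where Hh: "H N = mat_diag N (\<lambda>i. h i * grid_dx xL xR N)"
    and Dm: "Dm N \<in> carrier_mat N N" and Dp: "Dp N \<in> carrier_mat N N"
    and pos: "\<And>x. x \<in> carrier_vec N \<Longrightarrow> x \<noteq> 0\<^sub>v N \<Longrightarrow> ip_H (H N) x x > 0"
    and sbp: "\<And>x y. x \<in> carrier_vec N \<Longrightarrow> y \<in> carrier_vec N \<Longrightarrow>
      ip_H (H N) (Dp N *\<^sub>v x) y + ip_H (H N) x (Dm N *\<^sub>v y) =
        x $ (N - 1) * y $ (N - 1) - x $ 0 * y $ 0"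
    unfolding dp_sbp_triplet_def by blast
  define w where "w = (\<lambda>i. h i * grid_dx xL xR N)"
  define ci where "ci = (\<lambda>i. c (grid_pt xL xR N i))"
  define si where "si = (\<lambda>i. \<sigma> (grid_pt xL xR N i))"
  have H: "H N = mat_diag N w" and C: "C = mat_diag N ci" and Sg: "Sg = mat_diag N si"
    by (simp_all add: Hh w_def C_def Sg_def grid_diag_def ci_def si_def)
  \<comment> \<open>Positivity is given for the quadratic form; a unit vector isolates a single
    weight.\<close>
  have w: "w i > 0" if i: "i < N" for i
  proof -
    have "unit_vec N i \<noteq> (0\<^sub>v N :: real vec)"
      using i by (metis index_unit_vec(1) index_zero_vec(1) zero_neq_one)
    then have "ip_H (H N) (unit_vec N i) (unit_vec N i) > 0" by (intro pos) auto
    also have "ip_H (H N) (unit_vec N i) (unit_vec N i) = (\<Sum>j<N. if j = i then w j else 0)"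
      unfolding H ip_H_mat_diag[OF unit_vec_carrier unit_vec_carrier] by (rule sum.cong) (use i in auto)
    finally show ?thesis using i by simp
  qed
  then have w0: "w i \<ge> 0" if "i < N" for i using that by (simp add: less_imp_le)
  \<comment> \<open>The wave speed is nonzero on the space interval only, so every grid point must
    be shown to lie there; \<open>N2\<close> makes the divisor in the mesh width positive.\<close>
  have c: "ci i \<noteq> 0" if i: "i < N" for i
  proof -
    have "real i * (xR - xL) \<le> (real N - 1) * (xR - xL)"
      using i N2 \<open>xL < xR\<close> by (intro mult_right_mono) linarith+
    then have "real i * (xR - xL) / (real N - 1) \<le> xR - xL"
      using N2 by (simp add: pos_divide_le_eq mult.commute)
    moreover have "real i * (xR - xL) / (real N - 1) \<ge> 0"
      using N2 \<open>xL < xR\<close> by simp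
    ultimately have "grid_pt xL xR N i \<in> {xL..xR}"
      by (simp add: grid_pt_def grid_dx_def)
    then show ?thesis using assms(10) by (simp add: ci_def)
  qed
  define W where "W = (\<lambda>s. norm_H (H N) (mat_inv C *\<^sub>v S s))"
  define P where "P = (\<lambda>s. (norm_H (H N) (mat_inv C *\<^sub>v (Sg *\<^sub>v v s)))\<^sup>2 + BT_h N \<alpha>L \<beta>L \<alpha>R \<beta>R v s)"
  obtain a where uv: "vec_deriv_on N {0..T} u v" and va: "vec_deriv_on N {0..T} v a"
    using assms(13) unfolding semidiscrete_solution_def by blast
  have v: "v s \<in> carrier_vec N" if "s \<in> {0..T}" for s
    using uv that by (simp add: vec_deriv_on_def)
  have S: "S s \<in> carrier_vec N" if "s \<in> {0..T}" for s
    using assms(11) that by blast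
  have q: "q s = P s / (2 * E s)" for s
    by (simp add: q_def decay_quotient_def P_def E_def)
  have BT: "BT_h N \<alpha>L \<beta>L \<alpha>R \<beta>R v s \<ge> 0" for s
  proof -
    \<comment> \<open>A quotient has the sign of the corresponding product.\<close>
    have "\<beta>R / \<alpha>R \<ge> 0" "\<beta>L / \<alpha>L \<le> 0"
      using assms(16,17) by (auto simp: zero_le_divide_iff divide_le_0_iff zero_le_mult_iff mult_le_0_iff)
    then have "\<beta>R / \<alpha>R * (v s $ (N - 1))\<^sup>2 \<ge> 0" "\<beta>L / \<alpha>L * (v s $ 0)\<^sup>2 \<le> 0"
      by (intro mult_nonneg_nonneg mult_nonpos_nonneg; simp)+
    then show ?thesis unfolding BT_h_def by linarith
  qed
  have P0: "P s \<ge> 0" for s using BT by (simp add: P_def)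
  have E0: "E s \<ge> 0" for s by (simp add: E_def energy_h_def)
  have q0: "q s \<ge> 0" for s using P0 E0 by (simp add: q)
  have W0: "W s \<ge> 0" if "s \<in> {0..T}" for s
  proof -
    have "mat_inv C *\<^sub>v S s \<in> carrier_vec N"
      unfolding C using c S[OF that] by (simp add: mat_inv_mat_diag_mult_vec)
    then show ?thesis
      unfolding W_def norm_H_def H
      using w0 by (auto simp: ip_H_mat_diag mult.assoc intro!: sum_nonneg)
  qed
  define E' where "E' = (\<lambda>s. ip_H (H N) (mat_inv C *\<^sub>v v s) (mat_inv C *\<^sub>v S s) - P s)"
  have dE: "(E has_real_derivative E' s) (at s within {0..T})" if s: "s \<in> {0..T}" for s
    unfolding E_def E'_def P_def
    using energy_rate[OF _ w c Dm Dp sbp H C Sg assms(13) s S[OF s]] N2 by simp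
  have E'_le: "E' s \<le> 2 * sqrt (E s) * W s - P s" if s: "s \<in> {0..T}" for s
  proof -
    let ?x = "mat_inv C *\<^sub>v v s"
    have x: "?x \<in> carrier_vec N" and y: "mat_inv C *\<^sub>v S s \<in> carrier_vec N"
      unfolding C using c S[OF s] v[OF s] by (simp_all add: mat_inv_mat_diag_mult_vec)
    \<comment> \<open>Since the energy is half a sum of squares, 2 would do in place of 4. The
      looser constant yields \<open>2 * sqrt (E s)\<close>, the coefficient in
      \<open>sqrt_energy_gronwall\<close>, and hence the factor 1 before the integral.\<close>
    have "(norm_H (H N) ?x)\<^sup>2 \<le> 4 * E s"
      by (simp add: E_def energy_h_def add_increasing)
    then have "norm_H (H N) ?x \<le> sqrt (4 * E s)" by (rule real_le_rsqrt)
    then have "norm_H (H N) ?x \<le> 2 * sqrt (E s)" by (simp add: real_sqrt_mult)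
    then have "norm_H (H N) ?x * W s \<le> 2 * sqrt (E s) * W s"
      using W0[OF s] by (rule mult_right_mono)
    moreover have "ip_H (H N) ?x (mat_inv C *\<^sub>v S s) \<le> norm_H (H N) ?x * W s"
      unfolding W_def H using x y w0 by (rule ip_H_Cauchy_Schwarz)
    ultimately show ?thesis by (simp add: E'_def)
  qed
  have cont_v: "continuous_on {0..T} (\<lambda>s. v s $ i)" if "i < N" for i
    using va that by (intro DERIV_continuous_on) (auto simp: vec_deriv_on_def)
  have cont_E: "continuous_on {0..T} E" using dE by (rule DERIV_continuous_on)
  \<comment> \<open>Written out in components, \<open>P\<close> is a polynomial in the entries of
    \<open>v s\<close>, whose continuity is known.\<close>
  have P_eq: "P s = (\<Sum>i<N. w i * (si i * v s $ i / ci i)\<^sup>2) + BT_h N \<alpha>L \<beta>L \<alpha>R \<beta>R v s"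
    if "s \<in> {0..T}" for s
    using v[OF that] c w0
    by (simp add: P_def C Sg H mat_diag_mult_vec mat_inv_mat_diag_mult_vec norm_H_power2_mat_diag)
  have "continuous_on {0..T} (\<lambda>s. (\<Sum>i<N. w i * (si i * v s $ i / ci i)\<^sup>2) + BT_h N \<alpha>L \<beta>L \<alpha>R \<beta>R v s)"
    unfolding BT_h_def using cont_v N2 c by (intro continuous_intros) auto
  then have cont_P: "continuous_on {0..T} P"
    by (rule continuous_on_cong[THEN iffD1, rotated 2]) (simp_all add: P_eq)
  have sub: "{0..t} \<subseteq> {0..T}" using t by auto
  obtain m where m: "m \<in> {0..t}" "\<And>r. r \<in> {0..t} \<Longrightarrow> q m \<le> q r"
    using nonneg_quotient_attains_min[of 0 t P "\<lambda>s. 2 * E s"] t P0 E0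
      continuous_on_subset[OF cont_P sub]
      continuous_on_mult_left[OF continuous_on_subset[OF cont_E sub], of 2]
    by (auto simp: q)
  \<comment> \<open>The infimum is attained at \<open>m\<close>, so it is a genuine minimum.\<close>
  have \<gamma>: "\<gamma> t = q m"
    unfolding \<gamma>_def by (rule cInf_eq_minimum) (use m in auto)
  have "W integrable_on {0..T}" using assms(12) by (simp add: W_def)
  then have W_int: "W integrable_on {0..t}"
    using sub by (rule integrable_on_subinterval)
  \<comment> \<open>Where the energy vanishes, \<open>q\<close> is a junk value and only \<open>P \<ge> 0\<close> helps.\<close>
  have "2 * \<gamma> t * E s \<le> P s" if "s \<in> {0..t}" for s
  proof (cases "E s = 0")
    case False
    then have "E s > 0" using E0[of s] by simp
    then show ?thesis using m(2)[OF that] by (simp add: \<gamma> q[of s] le_divide_eq mult_ac)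
  qed (simp add: P0)
  then have "E' s \<le> - 2 * \<gamma> t * E s + 2 * sqrt (E s) * W s" if "s \<in> {0..t}" for s
    using E'_le[of s] that sub by fastforce
  \<comment> \<open>The rate depends on the end point: for each \<open>t\<close> the inequality is
    applied on \<open>{0..t}\<close> with the constant \<open>\<gamma> t\<close>, and derivatives
    within \<open>{0..T}\<close> are restricted to that interval.\<close>
  then have "sqrt (E t) \<le> exp (- \<gamma> t * t) * (sqrt (E 0) + integral {0..t} (\<lambda>s. exp (\<gamma> t * s) * W s))"
    using t sub W_int
    by (intro sqrt_energy_gronwall[where E' = E']) (auto intro: DERIV_subset[OF dE] E0 W0)
  \<comment> \<open>This certifies that the integral in the bound is not the default value 0 of a
    non-integrable function.\<close>
  moreover have "(\<lambda>s. exp (\<gamma> t * s) * W s) integrable_on {0..t}"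
    using W_int sub W0 by (intro integrable_exp_times) auto
  ultimately show "BT_h N \<alpha>L \<beta>L \<alpha>R \<beta>R v t \<ge> 0 \<and>
           (\<exists>s\<in>{0..t}. q s = \<gamma> t \<and> (\<forall>r\<in>{0..t}. q s \<le> q r)) \<and>
           \<gamma> t \<ge> 0 \<and>
           (\<lambda>s. exp (\<gamma> t * s) * norm_H (H N) (mat_inv C *\<^sub>v S s)) integrable_on {0..t} \<and>
           sqrt (E t) \<le> exp (- \<gamma> t * t) *
             (sqrt (E 0) + integral {0..t} (\<lambda>s. exp (\<gamma> t * s) * norm_H (H N) (mat_inv C *\<^sub>v S s)))"
    using BT m q0[of m] by (auto simp: \<gamma> W_def)
qed

end
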